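(* Consider the switching-converter model and $T$-periodic steady-state solution with switching instant $d\in(0,T)$ described in the context, in the buck-converter case: $A_1=A_2$ invertible, $B_{21}=0$, $B_{12}=B_{22}$. Assume $1$ is not an eigenvalue of $e^{A_1T}$ and $\dot y^0(d^-)\ne\dot h(d)$. Then saddle-node bifurcation occurs, i.e. $\det[I-\Phi]=0$, if and only if $$C(I-e^{A_1T})^{-1}e^{A_1d}B_{11}v_s=\dot h(d).$$
   Context: Model. Let $A_1,A_2\in\mathbf R^{N\times N}$, $B_1=[B_{11},B_{12}]$, $B_2=[B_{21},B_{22}]\in\mathbf R^{N\times 2}$ (columns), $C\in\mathbf R^{1\times N}$, $\mathbf D\in\mathbf R^{1\times 2}$ be constant matrices and $u=(v_s,v_r)'\in\mathbf R^2$ a constant input (source voltage $v_s$, control signal $v_r$). Let $T>0$ be the clock period. In each clock period the dynamics is first in stage $S_1$: $\dot x=A_1x+B_1u$, and then switches to stage $S_2$: $\dot x=A_2x+B_2u$, until the end of the period. The switching occurs when $y:=Cx+\mathbf D u$ intersects the $T$-periodic ramp signal $h(t)$, with $h$ differentiable at the switching instant (for a ramp of amplitude $V_h$, $h(t)=V_ht/T$ on $[0,T)$). Steady state. $x^0(t)$ is a $T$-periodic solution, in stage $S_1$ for $0\le t<d$ and in stage $S_2$ for $d\le t<T$, so $x^0(d)=e^{A_1d}x^0(0)+\int_0^d e^{A_1\sigma}d\sigma\,B_1u$, $x^0(0)=e^{A_2(T-d)}x^0(d)+\int_0^{T-d}e^{A_2\sigma}d\sigma\,B_2u$, and $Cx^0(d)+\mathbf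 D u=h(d)$. Write $y^0(t)=Cx^0(t)+\mathbf D u$, $\dot x^0(d^-)=A_1x^0(d)+B_1u$, $\dot x^0(d^+)=A_2x^0(d)+B_2u$, $\dot y^0(d^-)=C\dot x^0(d^-)$. Linearization. The Jacobian matrix of the linearized sampled-data dynamics is $$\Phi=e^{A_2(T-d)}\left(I-\frac{(\dot x^0(d^-)-\dot x^0(d^+))C}{\dot y^0(d^-)-\dot h(d)}\right)e^{A_1d}.$$ Saddle-node bifurcation is identified with the condition $\det[I-\Phi]=0$. *)

theory Defs
  imports "HOL-Analysis.Analysis"
begin

text \<open>
  The class instances on \<open>real^'n^'n\<close> make \<open>*\<close> and \<open>^\<close> componentwise, so the library
  \<open>exp\<close> is not available for matrices; the exponential series is written with \<open>**\<close>.
\<close>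

primrec mat_pow :: "real^'n^'n \<Rightarrow> nat \<Rightarrow> real^'n^'n" where
  "mat_pow A 0 = mat 1"
| "mat_pow A (Suc k) = A ** mat_pow A k"

definition mat_exp :: "real^'n^'n \<Rightarrow> real^'n^'n" where
  "mat_exp A = (\<Sum>k. (1 / fact k) *\<^sub>R mat_pow A k)"

lemma summable_mat_exp:
  fixes A :: "real^'n^'n"
  shows "summable (\<lambda>k. (1 / fact k) *\<^sub>R mat_pow A k)"
proof -
  have "bilinear ((**) :: real^'n^'n \<Rightarrow> real^'n^'n \<Rightarrow> real^'n^'n)"
    unfolding bilinear_def
    by (auto intro!: linearI
        simp: matrix_matrix_mult_def vec_eq_iff sum.distrib sum_distrib_left algebra_simps)
  then have bb: "bounded_bilinear ((**) :: real^'n^'n \<Rightarrow> real^'n^'n \<Rightarrow> real^'n^'n)"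
    by (simp add: bilinear_conv_bounded_bilinear)
  obtain K where K: "K > 0"
    and le: "\<And>(X :: real^'n^'n) (Y :: real^'n^'n). norm (X ** Y) \<le> norm X * norm Y * K"
    using bounded_bilinear.pos_bounded[OF bb] by auto
  define c where "c = norm (mat 1 :: real^'n^'n)"
  have pow: "norm (mat_pow A k) \<le> c * (K * norm A) ^ k" for k
  proof (induction k)
    case 0
    show ?case by (simp add: c_def)
  next
    case (Suc k)
    have "norm (mat_pow A (Suc k)) \<le> norm A * norm (mat_pow A k) * K"
      using le by simp
    also have "\<dots> \<le> norm A * (c * (K * norm A) ^ k) * K"
      using Suc K by (intro mult_right_mono mult_left_mono) auto
    finally show ?case by (simp add: algebra_simps)
  qed
  have "summable (\<lambda>k. c * (inverse (fact k) * (K * norm A) ^ k))"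
    by (intro summable_mult summable_exp)
  then show ?thesis
  proof (rule summable_comparison_test')
    fix k :: nat assume "k \<ge> 0"
    show "norm ((1 / fact k) *\<^sub>R mat_pow A k) \<le> c * (inverse (fact k) * (K * norm A) ^ k)"
      using mult_left_mono[OF pow[of k], of "inverse (fact k)"]
      by (simp add: field_simps)
  qed
qed

definition is_eigenvalue :: "real^'n^'n \<Rightarrow> real \<Rightarrow> bool" where
  "is_eigenvalue M \<mu> \<longleftrightarrow> (\<exists>v. v \<noteq> 0 \<and> M *v v = \<mu> *s v)"

definition stage_field :: "real^'n^'n \<Rightarrow> real^2^'n \<Rightarrow> real^2 \<Rightarrow> real^'n \<Rightarrow> real^'n" where
  "stage_field A B u x = A *v x + B *v u"

text \<open>\<open>C\<close> and \<open>D\<close> are matrices with one row; \<open>$ 1\<close> reads off the scalar.\<close>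

definition output_signal :: "real^'n^1 \<Rightarrow> real^2^1 \<Rightarrow> real^2 \<Rightarrow> real^'n \<Rightarrow> real" where
  "output_signal C D u x = (C *v x + D *v u) $ 1"

text \<open>
  At the ends \<open>0\<close>, \<open>d\<close>, \<open>T\<close> of the stages the derivatives are one-sided, and having both of them
  at \<open>d\<close> makes \<open>x\<close> continuous there.
\<close>

definition periodic_steady_state ::
  "real^'n^'n \<Rightarrow> real^'n^'n \<Rightarrow> real^2^'n \<Rightarrow> real^2^'n \<Rightarrow> real^'n^1 \<Rightarrow> real^2^1 \<Rightarrow> real^2
    \<Rightarrow> (real \<Rightarrow> real) \<Rightarrow> real \<Rightarrow> real \<Rightarrow> (real \<Rightarrow> real^'n) \<Rightarrow> bool" where
  "periodic_steady_state A1 A2 B1 B2 C D u h T d x \<longleftrightarrow>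
     (\<forall>t. x (t + T) = x t) \<and>
     (\<forall>t\<in>{0..d}. (x has_vector_derivative stage_field A1 B1 u (x t)) (at t within {0..d})) \<and>
     (\<forall>t\<in>{d..T}. (x has_vector_derivative stage_field A2 B2 u (x t)) (at t within {d..T})) \<and>
     output_signal C D u (x d) = h d"

text \<open>
  In the next two definitions \<open>x\<close> is the periodic orbit, so that \<open>stage_field A1 B1 u (x d)\<close> and
  \<open>stage_field A2 B2 u (x d)\<close> are its derivatives from the left and from the right at \<open>d\<close>.
\<close>

definition output_deriv_left ::
  "real^'n^'n \<Rightarrow> real^2^'n \<Rightarrow> real^'n^1 \<Rightarrow> real^2 \<Rightarrow> real \<Rightarrow> (real \<Rightarrow> real^'n) \<Rightarrow> real" where
  "output_deriv_left A1 B1 C u d x = (C *v stage_field A1 B1 u (x d)) $ 1"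

definition sampled_jacobian ::
  "real^'n^'n \<Rightarrow> real^'n^'n \<Rightarrow> real^2^'n \<Rightarrow> real^2^'n \<Rightarrow> real^'n^1 \<Rightarrow> real^2
    \<Rightarrow> (real \<Rightarrow> real) \<Rightarrow> real \<Rightarrow> real \<Rightarrow> (real \<Rightarrow> real^'n) \<Rightarrow> real^'n^'n" where
  "sampled_jacobian A1 A2 B1 B2 C u h T d x =
     mat_exp ((T - d) *\<^sub>R A2) **
     (mat 1 - (1 / (output_deriv_left A1 B1 C u d x - deriv h d)) *\<^sub>R
        ((columnvector (stage_field A1 B1 u (x d) - stage_field A2 B2 u (x d)) :: real^1^'n) ** C)) **
     mat_exp (d *\<^sub>R A1)"

definition saddle_node ::
  "real^'n^'n \<Rightarrow> real^'n^'n \<Rightarrow> real^2^'n \<Rightarrow> real^2^'n \<Rightarrow> real^'n^1 \<Rightarrow> real^2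
    \<Rightarrow> (real \<Rightarrow> real) \<Rightarrow> real \<Rightarrow> real \<Rightarrow> (real \<Rightarrow> real^'n) \<Rightarrow> bool" where
  "saddle_node A1 A2 B1 B2 C u h T d x \<longleftrightarrow>
     det (mat 1 - sampled_jacobian A1 A2 B1 B2 C u h T d x) = 0"

end

(* Write E t for e^{tA}, w for B11 vs and p for the left derivative of the orbit at d. With equal
   stage matrices, Phi is a rank-one perturbation of E T, so det (I - Phi) = 0 becomes
   C p - h'(d) + C (I - E T)^{-1} E T w = 0. The derivative of the orbit solves y' = A y in both
   stages and drops by w at d and rises by w at the end of the period, so periodicity gives
   (I - E T) p = (E d - E T) w, and the two terms with E T w cancel. *)

theory Submission
  imports Defs
begin

section \<open>The matrix exponential and its derivative\<close>

lemma bounded_bilinear_matrix_mult: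
  "bounded_bilinear ((**) :: real^'n^'m \<Rightarrow> real^'p^'n \<Rightarrow> real^'p^'m)"
proof -
  have "bilinear ((**) :: real^'n^'m \<Rightarrow> real^'p^'n \<Rightarrow> real^'p^'m)"
    unfolding bilinear_def
    by (auto intro!: linearI
        simp: matrix_matrix_mult_def vec_eq_iff sum.distrib sum_distrib_left algebra_simps)
  then show ?thesis
    by (simp add: bilinear_conv_bounded_bilinear)
qed

lemma bounded_bilinear_matrix_vector_mult:
  "bounded_bilinear ((*v) :: real^'n^'m \<Rightarrow> real^'n \<Rightarrow> real^'m)"
proof -
  have "bilinear ((*v) :: real^'n^'m \<Rightarrow> real^'n \<Rightarrow> real^'m)"
    unfolding bilinear_def
    by (auto intro!: linearI
        simp: matrix_vector_mult_def vec_eq_iff sum.distrib sum_distrib_left algebra_simps)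
  then show ?thesis
    by (simp add: bilinear_conv_bounded_bilinear)
qed

lemma mat_pow_scaleR: "mat_pow (t *\<^sub>R A) k = t ^ k *\<^sub>R mat_pow A k"
  by (induction k) (simp_all add: 
        bounded_bilinear.scaleR_left[OF bounded_bilinear_matrix_mult]
        bounded_bilinear.scaleR_right[OF bounded_bilinear_matrix_mult] mult.commute)

lemma mat_pow_commutes: "mat_pow A k ** A = A ** mat_pow A k"
  by (induction k) (simp_all add: matrix_mul_assoc[symmetric])

lemma mat_exp_0: "mat_exp (0 :: real^'n^'n) = mat 1"
proof -
  have "mat_exp (0 :: real^'n^'n) = (\<Sum>k\<in>{0}. (1 / fact k) *\<^sub>R mat_pow 0 k)"
    unfolding mat_exp_def
  proof (rule suminf_finite)
    fix k :: nat assume "k \<notin> {0}"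
    then show "(1 / fact k) *\<^sub>R mat_pow (0 :: real^'n^'n) k = 0"
      by (cases k) (simp_all add: bounded_bilinear.zero_left[OF bounded_bilinear_matrix_mult])
  qed simp
  then show ?thesis by simp
qed

text \<open>Every power of \<open>A\<close> commutes with \<open>A\<close>, and bounded linearity
  carries left and right multiplication by \<open>A\<close> inside the series. The cancellation in
  \<open>linear_ode_solution\<close> rests on this.\<close>

lemma mat_exp_commutes: "mat_exp (t *\<^sub>R A) ** A = A ** mat_exp (t *\<^sub>R A)"
proof -
  have s: "summable (\<lambda>k. (1 / fact k) *\<^sub>R mat_pow (t *\<^sub>R A) k)"
    by (rule summable_mat_exp)
  show ?thesis
    unfolding mat_exp_def
      bounded_linear.suminf[OF bounded_bilinear.bounded_linear_left[OF bounded_bilinear_matrix_mult] s]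
      bounded_linear.suminf[OF bounded_bilinear.bounded_linear_right[OF bounded_bilinear_matrix_mult] s]
    by (simp add: mat_pow_scaleR mat_pow_commutes 
        bounded_bilinear.scaleR_left[OF bounded_bilinear_matrix_mult]
        bounded_bilinear.scaleR_right[OF bounded_bilinear_matrix_mult])
qed

lemma bounded_linear_entry: "bounded_linear (\<lambda>M :: real^'n^'m. M $ i $ j)"
  using bounded_linear_compose[OF bounded_linear_vec_nth bounded_linear_vec_nth] .

text \<open>Each entry is a real power series in \<open>t\<close> converging everywhere, so it can
  be differentiated term by term. Entries are the coordinates in \<open>Basis\<close>, which gives
  differentiability of the whole matrix.\<close>

lemma mat_exp_has_vector_derivative:
  fixes A :: "real^'n^'n"
  shows "((\<lambda>t. mat_exp (t *\<^sub>R A)) has_vector_derivative A ** mat_exp (t *\<^sub>R A)) (at t)"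
proof -
  have entry: "((\<lambda>t. mat_exp (t *\<^sub>R A) $ i $ j) has_real_derivative (A ** mat_exp (t *\<^sub>R A)) $ i $ j) (at t)"
    for i j
  proof -
    define c where "c k = (mat_pow A k $ i $ j) / fact k" for k
    have sm: "summable (\<lambda>k. (1 / fact k) *\<^sub>R mat_pow (s *\<^sub>R A) k)" for s
      by (rule summable_mat_exp)
    have exp_c: "mat_exp (s *\<^sub>R A) $ i $ j = (\<Sum>k. c k * s ^ k)" for s
      unfolding mat_exp_def bounded_linear.suminf[OF bounded_linear_entry sm]
      by (simp add: mat_pow_scaleR c_def mult.commute)
    have "summable (\<lambda>k. c k * s ^ k)" for s
      using bounded_linear.summable[OF bounded_linear_entry[of i j] sm[of s]]
      by (simp add: mat_pow_scaleR c_def mult.commute)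
    then have "((\<lambda>s. \<Sum>k. c k * s ^ k) has_real_derivative (\<Sum>k. diffs c k * t ^ k)) (at t)"
      by (rule termdiffs_strong_converges_everywhere)
    moreover have "(A ** mat_exp (t *\<^sub>R A)) $ i $ j = (\<Sum>k. diffs c k * t ^ k)"
    proof -
      have "(A ** mat_exp (t *\<^sub>R A)) $ i $ j =
          (\<Sum>k. (A ** ((1 / fact k) *\<^sub>R mat_pow (t *\<^sub>R A) k)) $ i $ j)"
        unfolding mat_exp_def
        by (rule bounded_linear.suminf[OF bounded_linear_compose[OF bounded_linear_entry
              bounded_bilinear.bounded_linear_right[OF bounded_bilinear_matrix_mult]] sm])
      also have "\<dots> = (\<Sum>k. diffs c k * t ^ k)"
        \<comment> \<open>\<open>diffs c k\<close> is \<open>c (Suc k)\<close> times k+1, and this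
          factor cancels against \<open>fact (Suc k)\<close>; removing \<open>of_nat_Suc\<close>
          keeps it in one piece.\<close>
        by (simp add: mat_pow_scaleR diffs_def c_def field_simps
            bounded_bilinear.scaleR_right[OF bounded_bilinear_matrix_mult]
            del: of_nat_Suc)
      finally show ?thesis .
    qed
    ultimately show ?thesis
      by (simp add: exp_c)
  qed
  have "((\<lambda>t. mat_exp (t *\<^sub>R A) \<bullet> b) has_derivative (\<lambda>x. (x *\<^sub>R (A ** mat_exp (t *\<^sub>R A))) \<bullet> b)) (at t)"
    if b: "b \<in> Basis" for b
  proof -
    obtain i j where "b = axis i (axis j 1)"
      using b by (auto simp: Basis_vec_def)
    then show ?thesis
      using entry[of i j] by (simp add: inner_axis has_field_derivative_def mult_commute_abs)
  qed
  then show ?thesis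
    unfolding has_vector_derivative_def by (subst has_derivative_componentwise_within) blast
qed

section \<open>Linear differential equations and the semigroup law\<close>

text \<open>
  \<open>mat_exp ((c - t) *\<^sub>R A) *v y t\<close> does not depend on \<open>t\<close>, which makes a uniqueness theorem for
  linear equations unnecessary.
\<close>

lemma linear_ode_solution:
  fixes A :: "real^'n^'n" and y :: "real \<Rightarrow> real^'n"
  assumes "a \<le> b"
    and deriv: "\<And>t. t \<in> {a..b} \<Longrightarrow> (y has_vector_derivative A *v y t) (at t within {a..b})"
  shows "mat_exp ((c - b) *\<^sub>R A) *v y b = mat_exp ((c - a) *\<^sub>R A) *v y a"
proof -
  let ?E = "\<lambda>t. mat_exp ((c - t) *\<^sub>R A)"
  have "((\<lambda>t. ?E t *v y t) has_vector_derivative 0) (at t within {a..b})" if "t \<in> {a..b}" for t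
  proof -
    have "((\<lambda>t. c - t) has_vector_derivative -1) (at t within {a..b})"
      by (auto intro!: derivative_eq_intros)
    from vector_diff_chain_within[OF this
        has_vector_derivative_at_within[OF mat_exp_has_vector_derivative]]
    have E: "(?E has_vector_derivative - (A ** ?E t)) (at t within {a..b})"
      by (simp add: o_def)
    \<comment> \<open>The product rule gives - A E y + E A y, which vanishes because
      \<open>A\<close> commutes with its exponentials.\<close>
    show ?thesis
      using bounded_bilinear.has_vector_derivative[OF bounded_bilinear_matrix_vector_mult E deriv[OF that]]
      by (simp add: matrix_vector_mul_assoc mat_exp_commutes
          bounded_bilinear.minus_left[OF bounded_bilinear_matrix_vector_mult])
  qed
  then obtain k where "\<And>t. t \<in> {a..b} \<Longrightarrow> ?E t *v y t = k"
    using has_vector_derivative_zero_constant[of "{a..b}" "\<lambda>t. ?E t *v y t"] by auto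
  then show ?thesis
    using \<open>a \<le> b\<close> by simp
qed

text \<open>The curve r -> e^{rA} v solves y' = A y. With \<open>c = s + t\<close>, the conserved
  quantity of \<open>linear_ode_solution\<close> equals the left side at r = t and the right side at
  r = 0. The sign of \<open>t\<close> makes {0..t} an interval to integrate over.\<close>

lemma mat_exp_add:
  fixes A :: "real^'n^'n"
  assumes "0 \<le> t"
  shows "mat_exp (s *\<^sub>R A) ** mat_exp (t *\<^sub>R A) = mat_exp ((s + t) *\<^sub>R A)"
proof -
  have "mat_exp (s *\<^sub>R A) *v (mat_exp (t *\<^sub>R A) *v v) = mat_exp ((s + t) *\<^sub>R A) *v v" for v
  proof -
    have "((\<lambda>t. mat_exp (t *\<^sub>R A) *v v) has_vector_derivative A *v (mat_exp (r *\<^sub>R A) *v v))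
        (at r within {0..t})" for r
      using bounded_linear.has_vector_derivative[OF
          bounded_bilinear.bounded_linear_left[OF bounded_bilinear_matrix_vector_mult]
          has_vector_derivative_at_within[OF mat_exp_has_vector_derivative]]
      by (simp add: matrix_vector_mul_assoc)
    from linear_ode_solution[OF assms this, of "s + t"] show ?thesis
      by (simp add: mat_exp_0)
  qed
  then show ?thesis
    by (simp add: matrix_eq matrix_vector_mul_assoc)
qed

text \<open>Along a solution the field is the velocity, and differentiating the affine equation
  removes the constant input: the velocity solves y' = A y. Following velocities instead of states
  avoids the integral terms of the variation of constants formula.\<close>

lemma stage_field_solution:
  fixes A :: "real^'n^'n" and x :: "real \<Rightarrow> real^'n"
  assumes "a \<le> b"
    and deriv: "\<forall>t\<in>{a..b}. (x has_vector_derivative stage_field A B u (x t)) (at t within {a..b})"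
  shows "stage_field A B u (x b) = mat_exp ((b - a) *\<^sub>R A) *v stage_field A B u (x a)"
proof -
  have "((\<lambda>t. stage_field A B u (x t)) has_vector_derivative A *v stage_field A B u (x t))
      (at t within {a..b})" if "t \<in> {a..b}" for t
    using bounded_linear.has_vector_derivative[OF
        bounded_bilinear.bounded_linear_right[OF bounded_bilinear_matrix_vector_mult]
        bspec[OF deriv that], of A]
    unfolding stage_field_def by (simp add: has_vector_derivative_add_const)
  from linear_ode_solution[OF assms(1) this, of b] show ?thesis
    by (simp add: mat_exp_0)
qed

section \<open>Singularity of a rank-one update\<close>

lemma det_eq_0_iff_kernel:
  fixes M :: "real^'n^'n"
  shows "det M = 0 \<longleftrightarrow> (\<exists>v. v \<noteq> 0 \<and> M *v v = 0)"
  using invertible_det_nz[of M] invertible_left_inverse[of M] matrix_left_invertible_ker[of M] by blast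

text \<open>Serves both to move the inverse across an equation and to obtain injectivity of
  \<open>M\<close>.\<close>

lemma matrix_inv_vector_eq_iff:
  fixes M :: "real^'n^'n"
  assumes "invertible M"
  shows "matrix_inv M *v a = b \<longleftrightarrow> a = M *v b"
proof -
  have "M ** matrix_inv M = mat 1 \<and> matrix_inv M ** M = mat 1"
    using assms unfolding invertible_def matrix_inv_def by (rule someI_ex)
  then show ?thesis
    by (metis matrix_vector_mul_assoc matrix_vector_mul_lid)
qed

lemma columnvector_mult_vector:
  "(columnvector w :: real^1^'n) *v z = (z $ 1) *\<^sub>R w"
  unfolding matrix_vector_mult_def by (simp add: columnvector_def vec_eq_iff)

text \<open>
  A kernel vector \<open>v\<close> must satisfy \<open>C F v \<noteq> 0\<close> because \<open>M\<close> is injective, so it is a nonzero multiple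
  of \<open>M\<^sup>-\<^sup>1 E w\<close>.
\<close>

lemma det_rank_one_update_eq_0_iff:
  fixes M E F :: "real^'n^'n" and C :: "real^'n^1" and w :: "real^'n"
  assumes "invertible M"
  shows "det (M + E ** ((columnvector w :: real^1^'n) ** C) ** F) = 0 \<longleftrightarrow>
    1 + (C *v (F *v (matrix_inv M *v (E *v w)))) $ 1 = 0"
proof -
  define g where "g = matrix_inv M *v (E *v w)"
  have Mg: "M *v g = E *v w"
    using matrix_inv_vector_eq_iff[OF assms] g_def by metis
  have inj: "v = v'" if "M *v v = M *v v'" for v v'
    using matrix_inv_vector_eq_iff[OF assms] that by metis
  \<comment> \<open>Since \<open>E *v w\<close> is \<open>M *v g\<close>, the factor
    \<open>M\<close> can be pulled out on the left; by injectivity only the kernel of v -> v + (C F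
    v) g remains to be studied.\<close>
  have mult: "(M + E ** ((columnvector w :: real^1^'n) ** C) ** F) *v v =
      M *v (v + ((C *v (F *v v)) $ 1) *\<^sub>R g)" for v
    by (simp add: matrix_vector_mult_add_rdistrib matrix_vector_right_distrib
        matrix_vector_mul_assoc[symmetric] columnvector_mult_vector matrix_vector_mult_scaleR Mg
        del: matrix_vector_mul_assoc)
  have "det (M + E ** ((columnvector w :: real^1^'n) ** C) ** F) = 0 \<longleftrightarrow>
      (\<exists>v. v \<noteq> 0 \<and> v + ((C *v (F *v v)) $ 1) *\<^sub>R g = 0)"
    unfolding det_eq_0_iff_kernel mult using inj[of _ 0] by (metis matrix_vector_mult_0_right)
  also have "\<dots> \<longleftrightarrow> 1 + (C *v (F *v g)) $ 1 = 0"
  proof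
    assume "\<exists>v. v \<noteq> 0 \<and> v + ((C *v (F *v v)) $ 1) *\<^sub>R g = 0"
    then obtain v where v: "v \<noteq> 0" "v + ((C *v (F *v v)) $ 1) *\<^sub>R g = 0" by blast
    define s where "s = (C *v (F *v v)) $ 1"
    have vs: "v = (- s) *\<^sub>R g" using v(2) by (simp add: s_def add_eq_0_iff2)
    then have "s \<noteq> 0" using v(1) by auto
    \<comment> \<open>Applying the functional v -> C F v to v = - s g reproduces \<open>s\<close> on
      the left, so the nonzero \<open>s\<close> can be divided out.\<close>
    moreover have "s = - s * (C *v (F *v g)) $ 1"
      using arg_cong[OF vs, of "\<lambda>v. (C *v (F *v v)) $ 1"]
      by (simp only: s_def[symmetric] matrix_vector_mult_scaleR vector_scaleR_component real_scaleR_def)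
    ultimately show "1 + (C *v (F *v g)) $ 1 = 0"
      by algebra
  next
    assume *: "1 + (C *v (F *v g)) $ 1 = 0"
    then have "g + ((C *v (F *v g)) $ 1) *\<^sub>R g = 0"
      by (metis scaleR_add_left scaleR_one scaleR_zero_left)
    moreover have "g \<noteq> 0" using * by auto
    ultimately show "\<exists>v. v \<noteq> 0 \<and> v + ((C *v (F *v v)) $ 1) *\<^sub>R g = 0" by blast
  qed
  finally show ?thesis by (simp add: g_def)
qed

section \<open>The buck converter\<close>

text \<open>The state terms cancel because both stages share \<open>A\<close>, the \<open>vr\<close>
  terms because the second columns agree; the source acts only in the first stage. The jump is
  therefore the same at every state.\<close>

lemma buck_stage_field_jump:
  fixes B1 B2 :: "real^2^'n"
  assumes "column 1 B2 = 0" and "column 2 B1 = column 2 B2"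
  shows "stage_field A B1 (vector [vs, vr]) x - stage_field A B2 (vector [vs, vr]) x = vs *s column 1 B1"
proof -
  have "B2 $ i $ 1 = 0" "B1 $ i $ 2 = B2 $ i $ 2" for i
    using assms by (simp_all add: column_def vec_eq_iff)
  then show ?thesis
    by (simp add: stage_field_def vec_eq_iff matrix_vector_mult_def[of B1] matrix_vector_mult_def[of B2]
        sum_2 column_def)
qed

theorem mainTheorem4:
  fixes A1 A2 :: "real^'n^'n" and B1 B2 :: "real^2^'n"
    and C :: "real^'n^1" and D :: "real^2^1"
    and u :: "real^2" and vs vr :: real
    and h :: "real \<Rightarrow> real" and T d :: real and x0 :: "real \<Rightarrow> real^'n"
  assumes "T > 0" and "0 < d" and "d < T"
    and "u = vector [vs, vr]"
    and "\<forall>t. h (t + T) = h t"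
    and "h differentiable (at d)"
    and "periodic_steady_state A1 A2 B1 B2 C D u h T d x0"
    and "A1 = A2" and "invertible A1"
    and "column 1 B2 = 0" and "column 2 B1 = column 2 B2"
    and "\<not> is_eigenvalue (mat_exp (T *\<^sub>R A1)) 1"
    and "output_deriv_left A1 B1 C u d x0 \<noteq> deriv h d"
  shows "saddle_node A1 A2 B1 B2 C u h T d x0 \<longleftrightarrow>
    (C *v (matrix_inv (mat 1 - mat_exp (T *\<^sub>R A1)) *v
       (mat_exp (d *\<^sub>R A1) *v (vs *s column 1 B1)))) $ 1 = deriv h d"
proof -
  define E where "E t = mat_exp (t *\<^sub>R A1)" for t
  define M where "M = mat 1 - E T"
  define w where "w = vs *s column 1 B1"
  define p where "p = stage_field A1 B1 u (x0 d)"
  define \<delta> where "\<delta> = (C *v p) $ 1 - deriv h d"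
  have E_add: "E s *v (E t *v v) = E (s + t) *v v" if "0 \<le> t" for s t v
    using mat_exp_add[OF that, of s A1] by (simp add: E_def matrix_vector_mul_assoc)
  have M_mult: "M *v v = v - E T *v v" for v
    by (simp add: M_def matrix_vector_mult_diff_rdistrib)
  have "v = 0" if "M *v v = 0" for v
    using that assms(12) by (auto simp: M_mult is_eigenvalue_def E_def)
  then have "invertible M"
    using det_eq_0_iff_kernel[of M] invertible_det_nz[of M] by blast
  note inv = matrix_inv_vector_eq_iff[OF this]

  have jump: "stage_field A1 B1 u x - stage_field A1 B2 u x = w" for x
    unfolding w_def assms(4) using assms(10,11) by (rule buck_stage_field_jump)
  then have jump': "stage_field A1 B2 u x = stage_field A1 B1 u x - w" for x
    by (metis diff_diff_eq2 add_diff_cancel_left')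
  have pss: "x0 (0 + T) = x0 0"
      "\<forall>t\<in>{0..d}. (x0 has_vector_derivative stage_field A1 B1 u (x0 t)) (at t within {0..d})"
      "\<forall>t\<in>{d..T}. (x0 has_vector_derivative stage_field A1 B2 u (x0 t)) (at t within {d..T})"
    using assms(7,8) unfolding periodic_steady_state_def by blast+
  have p_start: "p = E d *v stage_field A1 B1 u (x0 0)"
    using stage_field_solution[OF _ pss(2)] \<open>0 < d\<close> by (simp add: p_def E_def)
  \<comment> \<open>The second stage starts with velocity p - w. It ends at the state
    \<open>x0 0\<close> by periodicity, where its velocity is that of the first stage minus
    \<open>w\<close>.\<close>
  have "stage_field A1 B1 u (x0 0) - w = E (T - d) *v (p - w)"
    using stage_field_solution[OF _ pss(3)] \<open>d < T\<close> pss(1) by (simp add: p_def E_def jump')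
  then have "stage_field A1 B1 u (x0 0) = w + E (T - d) *v (p - w)"
    by (metis add_diff_cancel_left' diff_add_cancel add.commute)
  then have "p = E d *v w + E T *v (p - w)"
    using p_start matrix_vector_right_distrib E_add[of "T - d" d "p - w"] \<open>d < T\<close>
    by (metis add_diff_cancel_left' diff_add_cancel add.commute diff_ge_0_iff_ge less_imp_le)
  then have "M *v p = E d *v w - E T *v w"
    by (simp add: M_mult matrix_vector_mult_diff_distrib algebra_simps)
  then have p_eq: "p = matrix_inv M *v (E d *v w - E T *v w)"
    using inv by metis

  \<comment> \<open>\<open>E d\<close> commutes with \<open>M\<close>, hence with its inverse, and
    then merges with \<open>E (T - d)\<close> into \<open>E T\<close>.\<close>
  have commute: "E d *v (matrix_inv M *v (E (T - d) *v w)) = matrix_inv M *v (E T *v w)"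
  proof -
    define g where "g = matrix_inv M *v (E (T - d) *v w)"
    have "E (T - d) *v w = M *v g"
      using inv g_def by metis
    then have "E T *v w = E d *v (M *v g)"
      using E_add[of "T - d" d w] \<open>d < T\<close> by simp
    also have "\<dots> = M *v (E d *v g)"
      using \<open>0 < d\<close> \<open>T > 0\<close>
      by (simp add: M_mult matrix_vector_mult_diff_distrib E_add add.commute)
    finally show ?thesis
      using inv g_def by metis
  qed

  have "\<delta> \<noteq> 0"
    using assms(13) by (simp add: \<delta>_def p_def output_deriv_left_def)
  \<comment> \<open>On vectors, the outer exponentials of the Jacobian combine to
    \<open>E T\<close>, which leaves \<open>M\<close> plus a rank-one term; the scalar 1 / \<delta>
    is absorbed into the column.\<close>
  have "mat 1 - sampled_jacobian A1 A2 B1 B2 C u h T d x0 =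
      M + E (T - d) ** ((columnvector ((1 / \<delta>) *\<^sub>R w) :: real^1^'n) ** C) ** E d"
  proof (subst matrix_eq, intro allI)
    fix v
    show "(mat 1 - sampled_jacobian A1 A2 B1 B2 C u h T d x0) *v v =
        (M + E (T - d) ** ((columnvector ((1 / \<delta>) *\<^sub>R w) :: real^1^'n) ** C) ** E d) *v v"
      unfolding sampled_jacobian_def assms(8)[symmetric] output_deriv_left_def jump
      using \<open>0 < d\<close>
      by (simp add: p_def[symmetric] \<delta>_def[symmetric] E_def[symmetric] M_mult
          matrix_vector_mult_add_rdistrib matrix_vector_mult_diff_rdistrib
          matrix_vector_mult_diff_distrib matrix_vector_mul_assoc[symmetric]
          columnvector_mult_vector scaleR_matrix_vector_assoc[symmetric]
          matrix_vector_mult_scaleR E_add del: matrix_vector_mul_assoc)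
  qed
  then have "saddle_node A1 A2 B1 B2 C u h T d x0 \<longleftrightarrow>
      1 + (C *v (E d *v (matrix_inv M *v (E (T - d) *v ((1 / \<delta>) *\<^sub>R w))))) $ 1 = 0"
    unfolding saddle_node_def by (simp only: det_rank_one_update_eq_0_iff[OF \<open>invertible M\<close>])
  \<comment> \<open>Multiplication by the nonzero \<delta> clears the denominator.\<close>
  also have "\<dots> \<longleftrightarrow> \<delta> + (C *v (matrix_inv M *v (E T *v w))) $ 1 = 0"
    using \<open>\<delta> \<noteq> 0\<close> by (simp add: matrix_vector_mult_scaleR commute field_simps)
  also have "\<dots> \<longleftrightarrow> (C *v (matrix_inv M *v (E d *v w))) $ 1 = deriv h d"
    by (simp add: \<delta>_def p_eq matrix_vector_mult_diff_distrib)
  finally show ?thesis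
    by (simp add: M_def E_def w_def)
qed

end
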